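(* The following two mixed-integer linear programs are equivalent, in the sense that for every $\mathbf{x}\in\{0,1\}^N$, one of them has a feasible solution with this $\mathbf{x}$ if and only if the other does, and in that case the maximum objective value over the remaining variables is the same in both (in particular, their optimal objective values and their sets of optimal $\mathbf{x}$ coincide). (A) Maximize $\sum_{k=1}^K\sum_{\ell=1}^{L_k} r_{i_{k,\ell}}\, y_{k,\ell}\,\lambda_k$ over $\mathbf{x}\in\{0,1\}^N$ and real variables $y_{k,\ell}$ ($k\in[K]$, $\ell\in[L_k]$), subject to $$\sum_{\ell=1}^{L} y_{k,\ell}=\sum_{\ell=1}^{L} y_{k',\ell}\quad \forall k,k'\in[K],\ L\in[L_k]\text{ with }\{i_{k,1},\ldots,i_{k,L}\}=\{i_{k',1},\ldots,i_{k',L}\},$$ $$\sum_{\ell=1}^{L_k} y_{k,\ell}\le 1\quad \forall k\in[K],$$ $$x_{i_{k,\ell}}\le\sum_{\ell'=1}^{\ell} y_{k,\ell'}\quad \forall k\in[K],\ \ell\in[L_k],$$ $$0\le y_{k,\ell}\le x_{i_{k,\ell}}\quad \forall k\in[K],\ \ell\in[L_k].$$ (B) Maximize $\sum_{(E,i)\in\mathscr{P}} r_i\,\lambda_{E,i}\,(z_{E\cup\{i\}}-z_E)$ over $\mathbf{x}\in\{0,1\}^N$ and real variables $z_E$ ($E\in\mathscr{E}$), subject to $$0\le z_{E\cup\{i\}}-z_E\le x_i\quad\forall (E,i)\in\mathscr{P},$$ $$x_i\le z_{E\cup\{i\}}\quad\forall (E,i)\in\mathscr{P},$$ $$z_E\le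 1\quad\forall E\in\mathscr{E},$$ $$z_\emptyset=0.$$
   Context: Notation: $[n]=\{1,\ldots,n\}$. There are products $[N+1]$, where product $N+1$ is the no-purchase option, with revenues $r_1,\ldots,r_N>0$ and $r_{N+1}=0$. There are $K\ge 1$ rankings with probabilities $\lambda_1,\ldots,\lambda_K$ (nonnegative, summing to one). For each ranking $k\in[K]$, the sequence $i_{k,1},\ldots,i_{k,N+1}$ is a permutation of $[N+1]$ listing the products from most preferred to least preferred. $L_k$ is the number of products preferred to the no-purchase option by ranking $k$, so that $i_{k,L_k+1}=N+1$; it is assumed that $L_k\ge 1$ for all $k\in[K]$. The collection of exclusion sets is $$\mathscr{E}=\{E\subseteq[N]:\ \exists k\in[K],\ L\in\{0,\ldots,L_k\}\text{ such that }E=\{i_{k,1},\ldots,i_{k,L}\}\}$$ (with $L=0$ giving $E=\emptyset$). The collection of exclusion set and continuation pairs is $$\mathscr{P}=\{(E,i)\in\mathscr{E}\times[N]:\ \exists k\in[K],\ L\in\{0,\ldots,L_k-1\}\text{ such that }E=\{i_{k,1},\ldots,i_{k,L}\}\text{ and }i=i_{k,L+1}\}.$$ For $(E,i)\in\mathscr{P}$, $$\lambda_{E,i}=\sum_{k=1}^K \mathbb{I}\{E=\{i_{k,1},\ldots,i_{k,|E|}\}\text{ and }i=i_{k,|E|+1}\}\,\lambda_k.$$ *)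

theory Defs
  imports "HOL-Analysis.Analysis"
begin

text \<open>
  Products are the numbers \<open>1..N+1\<close>, with \<open>N+1\<close> the no-purchase option. A ranking is a function
  \<open>\<sigma>\<close>, meant to be a permutation of \<open>{1..N+1}\<close>, with \<open>\<sigma> l\<close> the \<open>l\<close>-th most preferred product;
  a family of rankings \<open>i\<close> has \<open>i k l\<close> for the product in position \<open>l\<close> of ranking \<open>k\<close>.
\<close>

definition num_preferred :: "nat \<Rightarrow> (nat \<Rightarrow> nat) \<Rightarrow> nat" where
  "num_preferred N \<sigma> =
     card {p \<in> {1..N}. inv_into {1..N+1} \<sigma> p < inv_into {1..N+1} \<sigma> (N+1)}"

lemma no_purchase_position:
  assumes "bij_betw \<sigma> {1..N+1} {1..N+1}"
  shows "num_preferred N \<sigma> \<le> N" and "\<sigma> (num_preferred N \<sigma> + 1) = N + 1"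
proof -
  define m where "m = inv_into {1..N+1} \<sigma> (N+1)"
  have inj: "inj_on \<sigma> {1..N+1}" and im: "\<sigma> ` {1..N+1} = {1..N+1}"
    using assms by (auto simp: bij_betw_def)
  have "N + 1 \<in> \<sigma> ` {1..N+1}" using im by simp
  then have m: "m \<in> {1..N+1}" "\<sigma> m = N + 1"
    unfolding m_def by (blast intro: inv_into_into, rule f_inv_into_f)
  have "{p \<in> {1..N}. inv_into {1..N+1} \<sigma> p < m} = \<sigma> ` {1..<m}"
  proof (intro set_eqI iffI)
    fix p assume p: "p \<in> {p \<in> {1..N}. inv_into {1..N+1} \<sigma> p < m}"
    then have pi: "p \<in> \<sigma> ` {1..N+1}" using im by auto
    from inv_into_into[OF pi] f_inv_into_f[OF pi] p show "p \<in> \<sigma> ` {1..<m}"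
      by (intro image_eqI[of _ _ "inv_into {1..N+1} \<sigma> p"]) auto
  next
    fix p assume "p \<in> \<sigma> ` {1..<m}"
    then obtain a where a: "a \<in> {1..<m}" "p = \<sigma> a" by blast
    then have aN: "a \<in> {1..N+1}" using m by auto
    have "p \<in> {1..N+1}" using a aN im by blast
    moreover have "p \<noteq> N + 1"
      using a aN m inj_onD[OF inj, of a m] by auto
    ultimately show "p \<in> {p \<in> {1..N}. inv_into {1..N+1} \<sigma> p < m}"
      using a inv_into_f_f[OF inj aN] by auto
  qed
  moreover have "inj_on \<sigma> {1..<m}"
    using inj by (rule inj_on_subset) (use m in auto)
  ultimately have "num_preferred N \<sigma> = m - 1"
    unfolding num_preferred_def m_def[symmetric] by (simp add: card_image)
  then show "num_preferred N \<sigma> \<le> N" "\<sigma> (num_preferred N \<sigma> + 1) = N + 1"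
    using m by auto
qed

definition exclusion_sets :: "nat \<Rightarrow> nat \<Rightarrow> (nat \<Rightarrow> nat \<Rightarrow> nat) \<Rightarrow> nat set set" where
  "exclusion_sets N K i =
     {E. E \<subseteq> {1..N} \<and> (\<exists>k\<in>{1..K}. \<exists>L\<in>{0..num_preferred N (i k)}. E = i k ` {1..L})}"

definition exclusion_pairs :: "nat \<Rightarrow> nat \<Rightarrow> (nat \<Rightarrow> nat \<Rightarrow> nat) \<Rightarrow> (nat set \<times> nat) set" where
  "exclusion_pairs N K i =
     {(E, j). E \<in> exclusion_sets N K i \<and> j \<in> {1..N} \<and>
        (\<exists>k\<in>{1..K}. \<exists>L\<in>{0..<num_preferred N (i k)}. E = i k ` {1..L} \<and> j = i k (L + 1))}"

definition pair_prob ::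
  "nat \<Rightarrow> (nat \<Rightarrow> real) \<Rightarrow> (nat \<Rightarrow> nat \<Rightarrow> nat) \<Rightarrow> nat set \<Rightarrow> nat \<Rightarrow> real" where
  "pair_prob K lam i E j =
     (\<Sum>k=1..K. of_bool (E = i k ` {1..card E} \<and> j = i k (card E + 1)) * lam k)"

text \<open>
  Decision vectors are extensional functions on their index sets, so that the assortment vectors
  are exactly the elements of \<open>{0,1}\<close> to the power \<open>N\<close>.
\<close>

definition binary_vectors :: "nat \<Rightarrow> (nat \<Rightarrow> real) set" where
  "binary_vectors N = {1..N} \<rightarrow>\<^sub>E {0, 1}"

definition ranking_feasible ::
  "nat \<Rightarrow> nat \<Rightarrow> (nat \<Rightarrow> nat \<Rightarrow> nat) \<Rightarrow> ((nat \<Rightarrow> real) \<times> (nat \<Rightarrow> nat \<Rightarrow> real)) set" where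
  "ranking_feasible N K i =
     {(x, y). x \<in> binary_vectors N \<and>
        y \<in> (\<Pi>\<^sub>E k\<in>{1..K}. {1..num_preferred N (i k)} \<rightarrow>\<^sub>E UNIV) \<and>
        (\<forall>k\<in>{1..K}. \<forall>k'\<in>{1..K}. \<forall>L\<in>{1..num_preferred N (i k)}.
           i k ` {1..L} = i k' ` {1..L} \<longrightarrow> (\<Sum>l=1..L. y k l) = (\<Sum>l=1..L. y k' l)) \<and>
        (\<forall>k\<in>{1..K}. (\<Sum>l=1..num_preferred N (i k). y k l) \<le> 1) \<and>
        (\<forall>k\<in>{1..K}. \<forall>l\<in>{1..num_preferred N (i k)}. x (i k l) \<le> (\<Sum>l'=1..l. y k l')) \<and>
        (\<forall>k\<in>{1..K}. \<forall>l\<in>{1..num_preferred N (i k)}. 0 \<le> y k l \<and> y k l \<le> x (i k l))}"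

definition ranking_objective ::
  "nat \<Rightarrow> nat \<Rightarrow> (nat \<Rightarrow> real) \<Rightarrow> (nat \<Rightarrow> real) \<Rightarrow> (nat \<Rightarrow> nat \<Rightarrow> nat) \<Rightarrow>
   (nat \<Rightarrow> nat \<Rightarrow> real) \<Rightarrow> real" where
  "ranking_objective N K r lam i y =
     (\<Sum>k=1..K. \<Sum>l=1..num_preferred N (i k). r (i k l) * y k l * lam k)"

definition exclusion_feasible ::
  "nat \<Rightarrow> nat \<Rightarrow> (nat \<Rightarrow> nat \<Rightarrow> nat) \<Rightarrow> ((nat \<Rightarrow> real) \<times> (nat set \<Rightarrow> real)) set" where
  "exclusion_feasible N K i =
     {(x, z). x \<in> binary_vectors N \<and>
        z \<in> exclusion_sets N K i \<rightarrow>\<^sub>E UNIV \<and>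
        (\<forall>(E, j)\<in>exclusion_pairs N K i. 0 \<le> z (E \<union> {j}) - z E \<and> z (E \<union> {j}) - z E \<le> x j) \<and>
        (\<forall>(E, j)\<in>exclusion_pairs N K i. x j \<le> z (E \<union> {j})) \<and>
        (\<forall>E\<in>exclusion_sets N K i. z E \<le> 1) \<and>
        z {} = 0}"

definition exclusion_objective ::
  "nat \<Rightarrow> nat \<Rightarrow> (nat \<Rightarrow> real) \<Rightarrow> (nat \<Rightarrow> real) \<Rightarrow> (nat \<Rightarrow> nat \<Rightarrow> nat) \<Rightarrow>
   (nat set \<Rightarrow> real) \<Rightarrow> real" where
  "exclusion_objective N K r lam i z =
     (\<Sum>(E, j)\<in>exclusion_pairs N K i. r j * pair_prob K lam i E j * (z (E \<union> {j}) - z E))"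

definition is_maximum :: "('a \<Rightarrow> real) \<Rightarrow> 'a set \<Rightarrow> real \<Rightarrow> bool" where
  "is_maximum f S v \<longleftrightarrow> v \<in> f ` S \<and> (\<forall>s\<in>S. f s \<le> v)"

text \<open>The first components of the optimal solutions of maximizing \<open>f\<close>, a function of the second
  component alone, over the feasible set \<open>S\<close>.\<close>

definition optimal_x :: "('b \<Rightarrow> real) \<Rightarrow> ('a \<times> 'b) set \<Rightarrow> 'a set" where
  "optimal_x f S = fst ` {s. is_arg_max (\<lambda>s. f (snd s)) (\<lambda>s. s \<in> S) s}"

end

theory Submission
  imports Defs
begin

text \<open>
  In both programs the continuous variables are determined by the assortment \<open>x\<close>. Walk down a
  ranking \<open>k\<close>: the partial sums \<open>y\<^sub>k\<^sub>,\<^sub>1 + \<dots> + y\<^sub>k\<^sub>,\<^sub>L\<close> in the first program, and the values \<open>z\<close> of the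
  sets of \<open>L\<close> most preferred products in the second, satisfy the same inequalities. They start at
  \<open>0\<close>, cannot move past a product that is not offered, and are forced up to their bound \<open>1\<close> by the
  first product that is offered. So both are the indicator \<open>hits x E\<close> that the prefix \<open>E\<close> contains an
  offered product (lemma \<open>first_hit_profile\<close>). Conversely, this indicator
  satisfies every constraint; in particular the coupling constraints of the first program hold
  because \<open>hits x E\<close> depends on the set \<open>E\<close> only and not on the ranking that produced it.

  Hence both feasible sets are graphs of functions of \<open>x\<close> over all binary vectors (lemmas
  \<open>exclusion_feasible_iff\<close> and \<open>ranking_feasible_iff\<close>). Along these graphs the objectives agree by
  exchanging two sums: the pairs \<open>(E, j)\<close> that collect the probability \<open>\<lambda>\<^sub>k\<close> are exactly the steps
  of ranking \<open>k\<close> before the no-purchase option (lemmas \<open>pairs_of_ranking\<close> and \<open>objectives_agree\<close>).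
  All maxima exist because there are finitely many binary vectors.
\<close>

section \<open>The value profile along a ranking\<close>

definition hits :: "(nat \<Rightarrow> real) \<Rightarrow> nat set \<Rightarrow> real" where
  "hits x E = of_bool (\<exists>p\<in>E. x p = 1)"

lemma hits_empty [simp]: "hits x {} = 0"
  by (simp add: hits_def)

lemma hits_cases: "hits x E \<in> {0, 1}"
  unfolding hits_def by (simp only: of_bool_def insert_iff split: if_split) simp

lemma hits_insert:
  assumes "x p \<in> {0, 1}"
  shows "hits x (insert p E) = max (x p) (hits x E)"
  using assms by (auto simp: hits_def)

lemma image_atLeastAtMost_Suc: "f ` {1..Suc l} = insert (f (Suc l)) (f ` {1..l})"
  by (simp add: atLeastAtMostSuc_conv)

text \<open>
  The constraints of either program along one ranking \<open>f\<close>, with \<open>s l\<close> the value accumulated after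
  \<open>l\<close> products: while nothing offered has been met the increments vanish, at the first offered
  product the lower bound \<open>1 \<le> s\<close> and the upper bound meet, and afterwards monotonicity keeps \<open>s\<close> at
  \<open>1\<close>.
\<close>

lemma first_hit_profile:
  fixes s :: "nat \<Rightarrow> real"
  assumes binary: "\<forall>l<n. x (f (Suc l)) \<in> {0, 1}"
  shows "(s 0 = 0 \<and>
          (\<forall>l<n. s l \<le> s (Suc l) \<and> s (Suc l) - s l \<le> x (f (Suc l)) \<and>
                 x (f (Suc l)) \<le> s (Suc l) \<and> s (Suc l) \<le> 1))
         \<longleftrightarrow> (\<forall>l\<le>n. s l = hits x (f ` {1..l}))" (is "?constraints \<longleftrightarrow> ?profile")
proof
  assume c: ?constraints
  show ?profile
  proof (intro allI impI)
    fix l assume "l \<le> n"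
    then show "s l = hits x (f ` {1..l})"
    proof (induction l)
      case 0
      then show ?case using c by simp
    next
      case (Suc l)
      then have IH: "s l = hits x (f ` {1..l})" and "l < n" by simp_all
      then have b: "x (f (Suc l)) \<in> {0, 1}"
        and "s l \<le> s (Suc l)" "s (Suc l) - s l \<le> x (f (Suc l))"
          "x (f (Suc l)) \<le> s (Suc l)" "s (Suc l) \<le> 1"
        using binary c by blast+
      moreover have "s l \<in> {0, 1}" unfolding IH by (rule hits_cases)
      ultimately have "s (Suc l) = max (x (f (Suc l))) (s l)" by auto
      then show ?case
        using hits_insert[where x = x and p = "f (Suc l)", OF b]
        by (simp only: image_atLeastAtMost_Suc IH)
    qed
  qed
next
  assume p: ?profile
  have "s l \<le> s (Suc l) \<and> s (Suc l) - s l \<le> x (f (Suc l)) \<and>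
        x (f (Suc l)) \<le> s (Suc l) \<and> s (Suc l) \<le> 1" if "l < n" for l
  proof -
    have b: "x (f (Suc l)) \<in> {0, 1}" using binary that by blast
    have "s l = hits x (f ` {1..l})" "s (Suc l) = hits x (f ` {1..Suc l})"
      using p that by auto
    then have "s (Suc l) = max (x (f (Suc l))) (s l)" "s l \<in> {0, 1}"
      using hits_insert[where x = x and p = "f (Suc l)", OF b] unfolding image_atLeastAtMost_Suc
      by (simp_all only: hits_cases)
    with b show ?thesis by auto
  qed
  with p show ?constraints by simp
qed

section \<open>Maximization over a graph\<close>

text \<open>
  When the second component of a feasible solution is a function of the first, maximization is over
  the first component alone.
\<close>

lemma optimal_x_graph:
  assumes "\<And>x y. (x, y) \<in> S \<longleftrightarrow> x \<in> B \<and> y = h x"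
  shows "optimal_x f S = {x \<in> B. \<forall>x'\<in>B. f (h x') \<le> f (h x)}"
  using assms by (force simp: optimal_x_def is_arg_max_def image_iff not_less)

lemma is_maximum_graph:
  assumes "\<And>x y. (x, y) \<in> S \<longleftrightarrow> x \<in> B \<and> y = h x"
  shows "is_maximum (\<lambda>(x, y). f y) S v \<longleftrightarrow> is_maximum (\<lambda>x. f (h x)) B v"
proof -
  have "S = (\<lambda>x. (x, h x)) ` B" using assms by auto
  then show ?thesis by (simp add: is_maximum_def image_image)
qed

lemma is_maximum_singleton: "is_maximum f {a} v \<longleftrightarrow> v = f a"
  by (auto simp: is_maximum_def)

lemma is_maximum_Max: "finite B \<Longrightarrow> B \<noteq> {} \<Longrightarrow> is_maximum f B (Max (f ` B))"
  by (simp add: is_maximum_def)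

lemma binary_vectors_cases: "x \<in> binary_vectors N \<Longrightarrow> p \<in> {1..N} \<Longrightarrow> x p \<in> {0, 1}"
  unfolding binary_vectors_def by (rule PiE_mem)

lemma finite_binary_vectors: "finite (binary_vectors N)"
  by (simp add: binary_vectors_def finite_PiE)

lemma binary_vectors_nonempty: "binary_vectors N \<noteq> {}"
  by (simp add: binary_vectors_def PiE_eq_empty_iff)

section \<open>Prefixes of rankings\<close>

locale ranking_family =
  fixes N K :: nat and i :: "nat \<Rightarrow> nat \<Rightarrow> nat"
  assumes some_ranking: "K \<ge> 1"
    and ranking_bij: "k \<in> {1..K} \<Longrightarrow> bij_betw (i k) {1..N+1} {1..N+1}"
begin

abbreviation preferred :: "nat \<Rightarrow> nat" where
  "preferred k \<equiv> num_preferred N (i k)"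

lemma preferred_le: "k \<in> {1..K} \<Longrightarrow> preferred k \<le> N"
  by (rule no_purchase_position(1)[OF ranking_bij])

lemma ranking_preferred: "k \<in> {1..K} \<Longrightarrow> i k (preferred k + 1) = N + 1"
  by (rule no_purchase_position(2)[OF ranking_bij])

lemma ranking_in_products:
  assumes k: "k \<in> {1..K}" and l: "l \<in> {1..preferred k}"
  shows "i k l \<in> {1..N}"
proof -
  have b: "bij_betw (i k) {1..N+1} {1..N+1}" by (rule ranking_bij[OF k])
  have mem: "l \<in> {1..N+1}" "preferred k + 1 \<in> {1..N+1}" using l preferred_le[OF k] by auto
  have "i k l \<noteq> i k (preferred k + 1)"
    using inj_onD[OF bij_betw_imp_inj_on[OF b] _ mem] l by auto
  moreover have "i k l \<in> {1..N+1}" using bij_betwE[OF b] mem by blast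
  ultimately show ?thesis using ranking_preferred[OF k] by auto
qed

lemma prefix_in_products:
  "k \<in> {1..K} \<Longrightarrow> L \<le> preferred k \<Longrightarrow> i k ` {1..L} \<subseteq> {1..N}"
  using ranking_in_products[of k] by fastforce

text \<open>A longer prefix reaches position \<open>preferred k + 1\<close>, the no-purchase option.\<close>

lemma prefix_length_le:
  assumes "k \<in> {1..K}" "i k ` {1..L} \<subseteq> {1..N}"
  shows "L \<le> preferred k"
proof (rule ccontr)
  assume "\<not> L \<le> preferred k"
  then have "i k (preferred k + 1) \<in> i k ` {1..L}" by simp
  with assms ranking_preferred show False by fastforce
qed

lemma card_prefix:
  assumes "k \<in> {1..K}" "L \<le> preferred k"
  shows "card (i k ` {1..L}) = L"
proof -
  have "inj_on (i k) {1..L}"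
    using inj_on_subset[OF bij_betw_imp_inj_on[OF ranking_bij[OF assms(1)]]]
      assms(2) preferred_le[OF assms(1)] by auto
  then show ?thesis by (simp add: card_image)
qed

lemma exclusion_sets_eq:
  "exclusion_sets N K i = {i k ` {1..L} | k L. k \<in> {1..K} \<and> L \<le> preferred k}"
  unfolding exclusion_sets_def using prefix_in_products by fastforce

lemma exclusion_pairs_eq:
  "exclusion_pairs N K i =
     {(i k ` {1..L}, i k (Suc L)) | k L. k \<in> {1..K} \<and> L < preferred k}"
  (is "_ = ?P")
proof
  show "exclusion_pairs N K i \<subseteq> ?P"
    unfolding exclusion_pairs_def by fastforce
  show "?P \<subseteq> exclusion_pairs N K i"
  proof
    fix q assume "q \<in> ?P"
    then obtain k L where q: "q = (i k ` {1..L}, i k (Suc L))"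
      and k: "k \<in> {1..K}" and L: "L < preferred k" by blast
    have "i k ` {1..L} \<in> exclusion_sets N K i"
      unfolding exclusion_sets_eq using k L by (auto intro: less_imp_le)
    moreover have "i k (Suc L) \<in> {1..N}" using k L by (intro ranking_in_products) auto
    moreover have "\<exists>k'\<in>{1..K}. \<exists>L'\<in>{0..<preferred k'}.
        i k ` {1..L} = i k' ` {1..L'} \<and> i k (Suc L) = i k' (L' + 1)"
      by (rule bexI[of _ k], rule bexI[of _ L]) (use k L in auto)
    ultimately show "q \<in> exclusion_pairs N K i"
      unfolding q exclusion_pairs_def mem_Collect_eq prod.case by (intro conjI)
  qed
qed

lemma finite_exclusion_pairs: "finite (exclusion_pairs N K i)"
  by (rule finite_subset[of _ "Pow {1..N} \<times> {1..N}"])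
    (auto simp: exclusion_pairs_def exclusion_sets_def)

lemma ball_exclusion_sets:
  "(\<forall>E\<in>exclusion_sets N K i. Q E) \<longleftrightarrow>
     (\<forall>k\<in>{1..K}. \<forall>L\<le>preferred k. Q (i k ` {1..L}))"
  unfolding exclusion_sets_eq by blast

lemma ball_exclusion_pairs:
  "(\<forall>(E, j)\<in>exclusion_pairs N K i. Q E j) \<longleftrightarrow>
     (\<forall>k\<in>{1..K}. \<forall>L<preferred k. Q (i k ` {1..L}) (i k (Suc L)))"
  unfolding exclusion_pairs_eq by blast

section \<open>The assortment determines the remaining variables\<close>

definition exclusion_completion :: "(nat \<Rightarrow> real) \<Rightarrow> nat set \<Rightarrow> real" where
  "exclusion_completion x = restrict (hits x) (exclusion_sets N K i)"

text \<open>The increment of \<open>hits x\<close> is \<open>1\<close> exactly at the first offered product of the ranking.\<close>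

definition ranking_completion :: "(nat \<Rightarrow> real) \<Rightarrow> nat \<Rightarrow> nat \<Rightarrow> real" where
  "ranking_completion x =
     (\<lambda>k\<in>{1..K}. \<lambda>l\<in>{1..preferred k}. hits x (i k ` {1..l}) - hits x (i k ` {1..l-1}))"

lemma binary_along_ranking:
  assumes "x \<in> binary_vectors N" "k \<in> {1..K}"
  shows "\<forall>l<preferred k. x (i k (Suc l)) \<in> {0, 1}"
  using binary_vectors_cases[OF assms(1)] ranking_in_products[OF assms(2)] by force

text \<open>
  Every exclusion set and every pair lies on some ranking, so the constraints split into the
  conditions of \<open>first_hit_profile\<close> for each ranking separately. Rankings that share a prefix \<open>E\<close>
  prescribe the same value \<open>hits x E\<close>, so these conditions are jointly satisfiable.
\<close>

lemma exclusion_feasible_iff: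
  "(x, z) \<in> exclusion_feasible N K i \<longleftrightarrow>
     x \<in> binary_vectors N \<and> z = exclusion_completion x"
proof (cases "x \<in> binary_vectors N")
  case False
  then show ?thesis by (simp add: exclusion_feasible_def)
next
  case x: True
  let ?ext = "z \<in> exclusion_sets N K i \<rightarrow>\<^sub>E UNIV"
  let ?step = "\<lambda>k l. z (i k ` {1..l}) \<le> z (i k ` {1..Suc l}) \<and>
    z (i k ` {1..Suc l}) - z (i k ` {1..l}) \<le> x (i k (Suc l)) \<and>
    x (i k (Suc l)) \<le> z (i k ` {1..Suc l}) \<and> z (i k ` {1..Suc l}) \<le> 1"
  \<comment> \<open>Every nonempty exclusion set is the end of a step, and \<open>z {} = 0\<close> bounds the empty one.\<close>
  have bound: "(\<forall>L\<le>n. z (i k ` {1..L}) \<le> 1) \<longleftrightarrow> (\<forall>l<n. z (i k ` {1..Suc l}) \<le> 1)"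
    if "z {} = 0" for k n
  proof -
    have "(\<forall>L\<le>n. Q L) \<longleftrightarrow> Q 0 \<and> (\<forall>l<n. Q (Suc l))" for Q :: "nat \<Rightarrow> bool"
      by (metis Suc_le_eq le0 not0_implies_Suc)
    from this[of "\<lambda>L. z (i k ` {1..L}) \<le> 1"] that show ?thesis by simp
  qed
  have "(x, z) \<in> exclusion_feasible N K i \<longleftrightarrow>
      ?ext \<and> z {} = 0 \<and> (\<forall>k\<in>{1..K}. \<forall>l<preferred k. ?step k l)"
  proof (cases "z {} = 0")
    case True
    have un: "i k ` {1..l} \<union> {i k (Suc l)} = i k ` {1..Suc l}" for k l
      by (simp only: image_atLeastAtMost_Suc Un_insert_right Un_empty_right)
    show ?thesis
      unfolding exclusion_feasible_def ball_exclusion_sets ball_exclusion_pairs bound[OF True]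
        mem_Collect_eq prod.case un diff_ge_0_iff_ge
      using x True by (simp only: imp_conjR all_conj_distrib ball_conj_distrib simp_thms conj_ac)
  next
    case False
    then show ?thesis by (simp add: exclusion_feasible_def)
  qed
  \<comment> \<open>Since there is a ranking, \<open>z {} = 0\<close> can be imposed once for each of them.\<close>
  also have "\<dots> \<longleftrightarrow> ?ext \<and> (\<forall>k\<in>{1..K}. z {} = 0 \<and> (\<forall>l<preferred k. ?step k l))"
    using some_ranking by auto
  also have "\<dots> \<longleftrightarrow> ?ext \<and> (\<forall>k\<in>{1..K}. \<forall>l\<le>preferred k. z (i k ` {1..l}) = hits x (i k ` {1..l}))"
  proof -
    have "z {} = 0 \<and> (\<forall>l<preferred k. ?step k l) \<longleftrightarrow>
        (\<forall>l\<le>preferred k. z (i k ` {1..l}) = hits x (i k ` {1..l}))" if "k \<in> {1..K}" for k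
      using first_hit_profile[where f = "i k" and s = "\<lambda>l. z (i k ` {1..l})",
          OF binary_along_ranking[OF x that]] by simp
    then show ?thesis by blast
  qed
  also have "\<dots> \<longleftrightarrow> ?ext \<and> (\<forall>E\<in>exclusion_sets N K i. z E = hits x E)"
    by (simp only: ball_exclusion_sets)
  also have "\<dots> \<longleftrightarrow> z = exclusion_completion x"
    unfolding exclusion_completion_def by (auto simp: PiE_iff fun_eq_iff extensional_def)
  finally show ?thesis using x by simp
qed

text \<open>
  Partial sums and increments determine each other, so the variables \<open>y\<close> are recovered from the
  profile of their partial sums.
\<close>

lemma eq_ranking_completion_iff:
  assumes "y \<in> (\<Pi>\<^sub>E k\<in>{1..K}. {1..preferred k} \<rightarrow>\<^sub>E UNIV)"
  shows "y = ranking_completion x \<longleftrightarrow>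
    (\<forall>k\<in>{1..K}. \<forall>L\<le>preferred k. (\<Sum>l=1..L. y k l) = hits x (i k ` {1..L}))"
proof
  assume y: "y = ranking_completion x"
  show "\<forall>k\<in>{1..K}. \<forall>L\<le>preferred k. (\<Sum>l=1..L. y k l) = hits x (i k ` {1..L})"
  proof (intro ballI allI impI)
    fix k L assume k: "k \<in> {1..K}" and "L \<le> preferred k"
    then show "(\<Sum>l=1..L. y k l) = hits x (i k ` {1..L})"
    proof (induction L)
      case (Suc L)
      then have "y k (Suc L) = hits x (i k ` {1..Suc L}) - hits x (i k ` {1..L})"
        by (simp add: y ranking_completion_def)
      with Suc show ?case by simp
    qed simp
  qed
next
  assume sums: "\<forall>k\<in>{1..K}. \<forall>L\<le>preferred k. (\<Sum>l=1..L. y k l) = hits x (i k ` {1..L})"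
  have step: "y k l = hits x (i k ` {1..l}) - hits x (i k ` {1..l-1})"
    if "k \<in> {1..K}" "l \<in> {1..preferred k}" for k l
  proof -
    obtain m where m: "l = Suc m" using \<open>l \<in> _\<close> by (cases l) auto
    then have "(\<Sum>l=1..Suc m. y k l) = hits x (i k ` {1..Suc m})"
      "(\<Sum>l=1..m. y k l) = hits x (i k ` {1..m})"
      using sums that by (simp_all only: m atLeastAtMost_iff Suc_leD)
    then show ?thesis using m by simp
  qed
  show "y = ranking_completion x"
  proof (intro ext)
    fix k l
    show "y k l = ranking_completion x k l"
    proof (cases "k \<in> {1..K}")
      case True
      then have "y k \<in> extensional {1..preferred k}" using PiE_mem[OF assms] by (auto simp: PiE_iff)
      with True step show ?thesis
        unfolding ranking_completion_def by (auto simp: extensional_def)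
    next
      case False
      then have "y k = undefined" using assms by (rule PiE_arb[rotated])
      with False show ?thesis unfolding ranking_completion_def by auto
    qed
  qed
qed

text \<open>
  The constraints on the partial sums of \<open>y\<close> along each ranking already force the profile
  \<open>hits x\<close>, and the coupling between rankings then follows. The coupling constraints bound \<open>L\<close> by
  \<open>preferred k\<close> alone, but equal prefixes of two rankings are both free of the no-purchase option,
  so \<open>L \<le> preferred k'\<close> as well and \<open>y k'\<close> is never read outside its domain.
\<close>

lemma ranking_feasible_iff:
  "(x, y) \<in> ranking_feasible N K i \<longleftrightarrow>
     x \<in> binary_vectors N \<and> y = ranking_completion x"
proof (cases "x \<in> binary_vectors N \<and> y \<in> (\<Pi>\<^sub>E k\<in>{1..K}. {1..preferred k} \<rightarrow>\<^sub>E UNIV)")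
  case False
  have "ranking_completion x \<in> (\<Pi>\<^sub>E k\<in>{1..K}. {1..preferred k} \<rightarrow>\<^sub>E UNIV)"
    unfolding ranking_completion_def by auto
  with False have "\<not> (x \<in> binary_vectors N \<and> y = ranking_completion x)" by blast
  moreover have "(x, y) \<notin> ranking_feasible N K i"
    unfolding ranking_feasible_def using False by blast
  ultimately show ?thesis by blast
next
  case True
  then have x: "x \<in> binary_vectors N" by simp
  define s where "s k L = (\<Sum>l=1..L. y k l)" for k L
  have s_Suc: "s k (Suc l) = s k l + y k (Suc l)" and s_0: "s k 0 = 0" for k l
    by (simp_all add: s_def)
  let ?coupled = "\<forall>k\<in>{1..K}. \<forall>k'\<in>{1..K}. \<forall>L\<in>{1..preferred k}.
    i k ` {1..L} = i k' ` {1..L} \<longrightarrow> s k L = s k' L"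
  let ?step = "\<lambda>k l. s k l \<le> s k (Suc l) \<and> s k (Suc l) - s k l \<le> x (i k (Suc l)) \<and>
    x (i k (Suc l)) \<le> s k (Suc l) \<and> s k (Suc l) \<le> 1"
  let ?profile = "\<forall>k\<in>{1..K}. \<forall>L\<le>preferred k. s k L = hits x (i k ` {1..L})"
  have ball_Suc: "(\<forall>l\<in>{1..n}. Q l) \<longleftrightarrow> (\<forall>l<n. Q (Suc l))" for n and Q :: "nat \<Rightarrow> bool"
    by (metis One_nat_def Suc_le_eq Suc_pred atLeastAtMost_iff le0 Suc_le_mono)
  \<comment> \<open>The total is the largest partial sum, so bounding it bounds all of them.\<close>
  have total: "s k n \<le> 1 \<longleftrightarrow> (\<forall>l<n. s k (Suc l) \<le> 1)"
    if mono: "\<forall>l<n. 0 \<le> y k (Suc l)" for k n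
  proof
    assume "s k n \<le> 1"
    moreover have "s k (Suc l) \<le> s k n" if "l < n" for l
      unfolding s_def
    proof (rule sum_mono2)
      fix b assume "b \<in> {1..n} - {1..Suc l}"
      then show "0 \<le> y k b" using mono[rule_format, of "b - 1"] by (cases b) auto
    qed (use that in auto)
    ultimately show "\<forall>l<n. s k (Suc l) \<le> 1" by force
  next
    assume "\<forall>l<n. s k (Suc l) \<le> 1"
    then show "s k n \<le> 1" by (cases n) (auto simp: s_0)
  qed
  have "(x, y) \<in> ranking_feasible N K i \<longleftrightarrow>
      ?coupled \<and> (\<forall>k\<in>{1..K}. s k (preferred k) \<le> 1) \<and>
      (\<forall>k\<in>{1..K}. \<forall>l<preferred k. x (i k (Suc l)) \<le> s k (Suc l)) \<and>
      (\<forall>k\<in>{1..K}. \<forall>l<preferred k. 0 \<le> y k (Suc l) \<and> y k (Suc l) \<le> x (i k (Suc l)))"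
    using True
    by (simp only: ranking_feasible_def s_def ball_Suc mem_Collect_eq prod.case simp_thms)
  also have "\<dots> \<longleftrightarrow> ?coupled \<and> (\<forall>k\<in>{1..K}. \<forall>l<preferred k. ?step k l)"
  proof -
    have "s k n \<le> 1 \<and> (\<forall>l<n. x (i k (Suc l)) \<le> s k (Suc l)) \<and>
        (\<forall>l<n. 0 \<le> y k (Suc l) \<and> y k (Suc l) \<le> x (i k (Suc l))) \<longleftrightarrow>
        (\<forall>l<n. ?step k l)" for k n
    proof (cases "\<forall>l<n. 0 \<le> y k (Suc l)")
      case True
      show ?thesis unfolding total[OF True] using True by (auto simp: s_Suc)
    next
      case False
      then show ?thesis by (auto simp: s_Suc)
    qed
    from this[symmetric] show ?thesis by (simp only: ball_conj_distrib)
  qed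
  also have "\<dots> \<longleftrightarrow> ?coupled \<and> ?profile"
  proof -
    have "(\<forall>l<preferred k. ?step k l) \<longleftrightarrow> (\<forall>L\<le>preferred k. s k L = hits x (i k ` {1..L}))"
      if "k \<in> {1..K}" for k
      using first_hit_profile[where f = "i k" and s = "s k", OF binary_along_ranking[OF x that]]
        s_0 by blast
    then show ?thesis by blast
  qed
  also have "\<dots> \<longleftrightarrow> ?profile"
  proof -
    have ?coupled if p: ?profile
    proof (intro ballI impI)
      fix k k' L assume k: "k \<in> {1..K}" "k' \<in> {1..K}" and L: "L \<in> {1..preferred k}"
        and eq: "i k ` {1..L} = i k' ` {1..L}"
      have "i k' ` {1..L} \<subseteq> {1..N}" unfolding eq[symmetric] using prefix_in_products[OF k(1)] L by simp
      then have "L \<le> preferred k'" by (rule prefix_length_le[OF k(2)])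
      with p k L eq show "s k L = s k' L" by simp
    qed
    then show ?thesis by blast
  qed
  also have "\<dots> \<longleftrightarrow> y = ranking_completion x"
    unfolding s_def using eq_ranking_completion_iff True by blast
  finally show ?thesis using x by simp
qed

section \<open>Equality of the objectives\<close>

text \<open>
  The condition under which \<open>\<lambda>\<^sub>k\<close> contributes to \<open>\<lambda>\<^sub>E\<^sub>,\<^sub>j\<close> refers to the position \<open>card E + 1\<close>; since
  \<open>E\<close> and \<open>j\<close> consist of real products, this position comes before the no-purchase option.
\<close>

lemma pairs_of_ranking:
  assumes k: "k \<in> {1..K}"
  shows "{(E, j) \<in> exclusion_pairs N K i. E = i k ` {1..card E} \<and> j = i k (card E + 1)} =
    (\<lambda>l. (i k ` {1..l-1}, i k l)) ` {1..preferred k}" (is "?P = ?I")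
proof (intro equalityI subsetI)
  fix q assume "q \<in> ?P"
  then obtain E j where q: "q = (E, j)" and E: "E \<subseteq> {1..N}" "E = i k ` {1..card E}"
    and j: "j \<in> {1..N}" "j = i k (card E + 1)"
    by (auto simp: exclusion_pairs_def exclusion_sets_def)
  have "card E \<le> preferred k" using prefix_length_le[OF k] E by simp
  moreover have "card E \<noteq> preferred k" using j ranking_preferred[OF k] by auto
  ultimately show "q \<in> ?I" using E j q by (intro image_eqI[of _ _ "card E + 1"]) auto
next
  fix q assume "q \<in> ?I"
  then obtain l where l: "l \<in> {1..preferred k}" "q = (i k ` {1..l-1}, i k l)" by blast
  then obtain m where m: "l = Suc m" "m < preferred k" by (cases l) auto
  have "q \<in> exclusion_pairs N K i" unfolding exclusion_pairs_eq using l m k by auto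
  moreover have "card (i k ` {1..m}) = m" using card_prefix k m by simp
  ultimately show "q \<in> ?P" using l m by simp
qed

text \<open>
  After the two sums are exchanged, ranking \<open>k\<close> selects its own pairs. It meets each of them once,
  since the position is recovered from the cardinality of \<open>E\<close>.
\<close>

lemma sum_exclusion_pairs:
  "(\<Sum>(E, j)\<in>exclusion_pairs N K i. pair_prob K lam i E j * g E j) =
     (\<Sum>k=1..K. \<Sum>l=1..preferred k. lam k * g (i k ` {1..l-1}) (i k l))"
proof -
  define C where "C k E j \<longleftrightarrow> E = i k ` {1..card E} \<and> j = i k (card E + 1)" for k E j
  have "(\<Sum>(E, j)\<in>exclusion_pairs N K i. pair_prob K lam i E j * g E j) =
      (\<Sum>k=1..K. \<Sum>(E, j)\<in>exclusion_pairs N K i. of_bool (C k E j) * (lam k * g E j))"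
    unfolding pair_prob_def C_def[symmetric] sum_distrib_right split_def mult.assoc by (rule sum.swap)
  also have "\<dots> = (\<Sum>k=1..K. \<Sum>l=1..preferred k. lam k * g (i k ` {1..l-1}) (i k l))"
  proof (rule sum.cong[OF refl])
    fix k assume k: "k \<in> {1..K}"
    let ?h = "\<lambda>l. (i k ` {1..l-1}, i k l)"
    have inj: "inj_on ?h {1..preferred k}"
    proof (rule inj_onI)
      fix l l' assume l: "l \<in> {1..preferred k}" "l' \<in> {1..preferred k}" "?h l = ?h l'"
      then have "card (i k ` {1..l-1}) = card (i k ` {1..l'-1})" by simp
      moreover have "l - 1 \<le> preferred k" "l' - 1 \<le> preferred k" using l(1,2) by auto
      ultimately have "l - 1 = l' - 1" using card_prefix[OF k] by simp
      with l(1,2) show "l = l'" by auto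
    qed
    have "(\<Sum>(E, j)\<in>exclusion_pairs N K i. of_bool (C k E j) * (lam k * g E j)) =
        (\<Sum>(E, j)\<in>{(E, j) \<in> exclusion_pairs N K i. C k E j}. lam k * g E j)"
      by (rule sum.mono_neutral_cong_right[OF finite_exclusion_pairs]) auto
    also have "\<dots> = (\<Sum>l=1..preferred k. lam k * g (i k ` {1..l-1}) (i k l))"
      unfolding C_def pairs_of_ranking[OF k] by (simp only: sum.reindex[OF inj] comp_def prod.case)
    finally show "(\<Sum>(E, j)\<in>exclusion_pairs N K i. of_bool (C k E j) * (lam k * g E j)) =
        (\<Sum>l=1..preferred k. lam k * g (i k ` {1..l-1}) (i k l))" .
  qed
  finally show ?thesis .
qed

lemma objectives_agree:
  "exclusion_objective N K r lam i (exclusion_completion x) =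
     ranking_objective N K r lam i (ranking_completion x)"
proof -
  let ?z = "exclusion_completion x"
  have "exclusion_objective N K r lam i ?z =
      (\<Sum>(E, j)\<in>exclusion_pairs N K i. pair_prob K lam i E j * (r j * (?z (E \<union> {j}) - ?z E)))"
    unfolding exclusion_objective_def by (simp add: mult.left_commute mult.assoc)
  also have "\<dots> = (\<Sum>k=1..K. \<Sum>l=1..preferred k.
      lam k * (r (i k l) * (?z (i k ` {1..l-1} \<union> {i k l}) - ?z (i k ` {1..l-1}))))"
    by (rule sum_exclusion_pairs)
  also have "\<dots> = ranking_objective N K r lam i (ranking_completion x)"
    unfolding ranking_objective_def
  proof (intro sum.cong refl)
    fix k l assume k: "k \<in> {1..K}" and l: "l \<in> {1..preferred k}"
    have un: "i k ` {1..l-1} \<union> {i k l} = i k ` {1..l}"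
      using l image_atLeastAtMost_Suc[of "i k" "l - 1"] by simp
    have mem: "i k ` {1..l} \<in> exclusion_sets N K i" "i k ` {1..l-1} \<in> exclusion_sets N K i"
      unfolding exclusion_sets_eq using k l by (fastforce intro: exI[of _ k])+
    show "lam k * (r (i k l) * (?z (i k ` {1..l-1} \<union> {i k l}) - ?z (i k ` {1..l-1}))) =
        r (i k l) * ranking_completion x k l * lam k"
      unfolding un using mem k l
      by (simp add: exclusion_completion_def ranking_completion_def)
  qed
  finally show ?thesis .
qed

end

theorem theorem1:
  fixes N K :: nat
    and r lam :: "nat \<Rightarrow> real"
    and i :: "nat \<Rightarrow> nat \<Rightarrow> nat"
  assumes "K \<ge> 1"
    and "\<forall>p\<in>{1..N}. r p > 0"
    and "r (N + 1) = 0"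
    and "\<forall>k\<in>{1..K}. lam k \<ge> 0"
    and "(\<Sum>k=1..K. lam k) = 1"
    and "\<forall>k\<in>{1..K}. bij_betw (i k) {1..N+1} {1..N+1}"
    and "\<forall>k\<in>{1..K}. num_preferred N (i k) \<ge> 1"
  shows
    "(\<forall>x\<in>binary_vectors N.
        ((\<exists>y. (x, y) \<in> ranking_feasible N K i) \<longleftrightarrow> (\<exists>z. (x, z) \<in> exclusion_feasible N K i)) \<and>
        ((\<exists>y. (x, y) \<in> ranking_feasible N K i) \<longrightarrow>
           (\<exists>v. is_maximum (ranking_objective N K r lam i) {y. (x, y) \<in> ranking_feasible N K i} v \<and>
                is_maximum (exclusion_objective N K r lam i) {z. (x, z) \<in> exclusion_feasible N K i} v))) \<and>
     (\<exists>v. is_maximum (\<lambda>(x, y). ranking_objective N K r lam i y) (ranking_feasible N K i) v \<and>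
          is_maximum (\<lambda>(x, z). exclusion_objective N K r lam i z) (exclusion_feasible N K i) v) \<and>
     optimal_x (ranking_objective N K r lam i) (ranking_feasible N K i) =
       optimal_x (exclusion_objective N K r lam i) (exclusion_feasible N K i)"
proof -
  interpret ranking_family N K i
    using assms(1,6) by unfold_locales auto
  let ?B = "binary_vectors N"
  let ?ranking = "ranking_objective N K r lam i" and ?exclusion = "exclusion_objective N K r lam i"
  have fibres: "{y. (x, y) \<in> ranking_feasible N K i} = {ranking_completion x}"
    "{z. (x, z) \<in> exclusion_feasible N K i} = {exclusion_completion x}" if "x \<in> ?B" for x
    using that by (auto simp: ranking_feasible_iff exclusion_feasible_iff)
  have "\<exists>v. is_maximum (\<lambda>x. ?ranking (ranking_completion x)) ?B v"
    by (rule exI, rule is_maximum_Max[OF finite_binary_vectors binary_vectors_nonempty])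
  then have "\<exists>v. is_maximum (\<lambda>(x, y). ?ranking y) (ranking_feasible N K i) v \<and>
      is_maximum (\<lambda>(x, z). ?exclusion z) (exclusion_feasible N K i) v"
    by (simp only: is_maximum_graph[OF ranking_feasible_iff] is_maximum_graph[OF exclusion_feasible_iff]
        objectives_agree simp_thms)
  moreover have "optimal_x ?ranking (ranking_feasible N K i) =
      optimal_x ?exclusion (exclusion_feasible N K i)"
    by (simp only: optimal_x_graph[OF ranking_feasible_iff] optimal_x_graph[OF exclusion_feasible_iff]
        objectives_agree)
  moreover have "((\<exists>y. (x, y) \<in> ranking_feasible N K i) \<longleftrightarrow> (\<exists>z. (x, z) \<in> exclusion_feasible N K i)) \<and>
      ((\<exists>y. (x, y) \<in> ranking_feasible N K i) \<longrightarrow>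
         (\<exists>v. is_maximum ?ranking {y. (x, y) \<in> ranking_feasible N K i} v \<and>
              is_maximum ?exclusion {z. (x, z) \<in> exclusion_feasible N K i} v))" if "x \<in> ?B" for x
    unfolding fibres[OF that] is_maximum_singleton objectives_agree
    using that by (simp add: ranking_feasible_iff exclusion_feasible_iff)
  ultimately show ?thesis by blast
qed

end
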